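(* Let $X$ be a topological space, let $\kappa$ be a generalized relative category on $X$, let $Y$ be a compact metric space of (finite) covering dimension $d$, and let $n$ be an integer. Suppose that $\kappa(X) > n(d+1)$. Then for any continuous map $f: X\to Y$ there exists a point $c\in Y$ such that for any (open) neighborhood $U\ni c$ in $Y$ (the preimage $f^{-1}(U)$ is nonempty and) $$ \kappa(f^{-1}(U)) > n. $$
   Context: Let $X$ be a topological space, and write $\operatorname{cl} U$ for the closure of $U$ in $X$. A generalized relative category on $X$ is a function $\kappa$ from the set of nonempty open subsets of $X$ to the positive integers with the following properties: 1) (monotonicity) if $U\subseteq V$, then $\kappa(U)\le\kappa(V)$; 2) (subadditivity) $\kappa(U_1\cup\dots\cup U_m)\le \kappa(U_1)+\dots+\kappa(U_m)$ for any finite collection of nonempty open sets $U_1,\dots,U_m$; 3) $\kappa(U_1\cup\dots\cup U_m)\le\max\{\kappa(U_1),\ldots,\kappa(U_m)\}$ for any finite collection of nonempty open sets $U_1,\dots,U_m$ such that $\operatorname{cl} U_1,\ldots,\operatorname{cl} U_m$ are pairwise disjoint. Since $\kappa$ is defined only on nonempty open sets, the hypothesis on $\kappa(X)$ includes that $X$ is nonempty. *)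

theory Defs
  imports "HOL-Analysis.Analysis"
begin

(* \<kappa> is a total function on sets; only its values on nonempty open sets are constrained.
   Finite collections are indexed families U 1, ..., U m with m >= 1. *)
definition generalized_relative_category :: "'a topology \<Rightarrow> ('a set \<Rightarrow> int) \<Rightarrow> bool" where
  "generalized_relative_category X \<kappa> \<longleftrightarrow>
     (\<forall>U. openin X U \<and> U \<noteq> {} \<longrightarrow> 0 < \<kappa> U) \<and>
     (\<forall>U V. openin X U \<and> U \<noteq> {} \<and> openin X V \<and> V \<noteq> {} \<and> U \<subseteq> V \<longrightarrow> \<kappa> U \<le> \<kappa> V) \<and>
     (\<forall>(m::nat) U. 1 \<le> m \<and> (\<forall>i\<in>{1..m}. openin X (U i) \<and> U i \<noteq> {}) \<longrightarrow>
        \<kappa> (\<Union>i\<in>{1..m}. U i) \<le> (\<Sum>i=1..m. \<kappa> (U i))) \<and>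
     (\<forall>(m::nat) U. 1 \<le> m \<and> (\<forall>i\<in>{1..m}. openin X (U i) \<and> U i \<noteq> {}) \<and>
        disjoint_family_on (\<lambda>i. X closure_of U i) {1..m} \<longrightarrow>
        \<kappa> (\<Union>i\<in>{1..m}. U i) \<le> Max ((\<lambda>i. \<kappa> (U i)) ` {1..m}))"

definition open_cover_of :: "'a topology \<Rightarrow> 'a set set \<Rightarrow> bool" where
  "open_cover_of X \<U> \<longleftrightarrow> (\<forall>U\<in>\<U>. openin X U) \<and> \<Union>\<U> = topspace X"

(* Covering dimension at most n: every open cover has an open refinement in which each point
   lies in at most n + 1 members. The case n = -1 characterizes the empty space, and the bound
   -1 <= n keeps that space from having every negative dimension. *)
definition covering_dim_le :: "'a topology \<Rightarrow> int \<Rightarrow> bool" where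
  "covering_dim_le X n \<longleftrightarrow> -1 \<le> n \<and>
     (\<forall>\<U>. open_cover_of X \<U> \<longrightarrow>
        (\<exists>\<V>. open_cover_of X \<V> \<and> (\<forall>V\<in>\<V>. \<exists>U\<in>\<U>. V \<subseteq> U) \<and>
          (\<forall>x\<in>topspace X. finite {V\<in>\<V>. x \<in> V} \<and> int (card {V\<in>\<V>. x \<in> V}) \<le> n + 1)))"

definition has_covering_dim :: "'a topology \<Rightarrow> int \<Rightarrow> bool" where
  "has_covering_dim X d \<longleftrightarrow> covering_dim_le X d \<and> (\<forall>k<d. \<not> covering_dim_le X k)"

end

theory Submission
  imports Defs
begin

text \<open>
  If no such \<open>c\<close> existed, \<open>Y\<close> would be covered by open sets whose preimages are empty or have
  \<open>\<kappa> \<le> n\<close>. Since \<open>Y\<close> is compact of dimension \<open>d\<close>, this cover has a finite open refinement that splits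
  into \<open>d + 1\<close> colours, the members of one colour having pairwise disjoint closures. The maximum
  axiom bounds the preimage of each colour by \<open>n\<close>, and subadditivity gives \<open>\<kappa> X \<le> n (d + 1)\<close>.
\<close>

section \<open>Axioms of a generalized relative category over finite index sets\<close>

lemma relative_category_pos:
  assumes "generalized_relative_category X \<kappa>" "openin X U" "U \<noteq> {}"
  shows "0 < \<kappa> U"
  using assms unfolding generalized_relative_category_def by blast

lemma relative_category_mono:
  assumes "generalized_relative_category X \<kappa>" "openin X U" "U \<noteq> {}" "openin X V" "U \<subseteq> V"
  shows "\<kappa> U \<le> \<kappa> V"
  using assms unfolding generalized_relative_category_def by blast

text \<open>The axiom speaks of families indexed by \<open>{1..m}\<close>; a bijection from
  \<open>{1..card I}\<close> carries it over to index sets such as sets of colours.\<close>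

lemma relative_category_UN_le_sum:
  assumes \<kappa>: "generalized_relative_category X \<kappa>"
    and I: "finite I" "I \<noteq> {}"
    and U: "\<And>i. i \<in> I \<Longrightarrow> openin X (U i) \<and> U i \<noteq> {}"
  shows "\<kappa> (\<Union>i\<in>I. U i) \<le> (\<Sum>i\<in>I. \<kappa> (U i))"
proof -
  obtain h where h: "bij_betw h {1..card I} I"
    using ex_bij_betw_nat_finite_1[OF I(1)] by blast
  have im: "h ` {1..card I} = I"
    using h by (simp add: bij_betw_def)
  have ge1: "1 \<le> card I"
    using I by (simp add: Suc_leI card_gt_0_iff)
  have Uh: "\<forall>j\<in>{1..card I}. openin X (U (h j)) \<and> U (h j) \<noteq> {}"
    using U im by blast
  have "\<kappa> (\<Union>j\<in>{1..card I}. U (h j)) \<le> (\<Sum>j=1..card I. \<kappa> (U (h j)))"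
    by (rule \<kappa>[unfolded generalized_relative_category_def, THEN conjunct2, THEN conjunct2,
          THEN conjunct1, THEN spec, THEN spec, THEN mp]) (intro conjI ge1 Uh)
  moreover have "(\<Sum>j=1..card I. \<kappa> (U (h j))) = (\<Sum>i\<in>I. \<kappa> (U i))"
    by (rule sum.reindex_bij_betw[OF h])
  moreover have "(\<Union>j\<in>{1..card I}. U (h j)) = (\<Union>i\<in>I. U i)"
    using arg_cong[OF im, of "\<lambda>J. \<Union>(U ` J)"] by (simp only: image_image)
  ultimately show ?thesis by simp
qed

text \<open>The same transport for the maximum axiom. Injectivity of the bijection preserves
  pairwise disjointness of the closures.\<close>

lemma relative_category_UN_le_bound:
  assumes \<kappa>: "generalized_relative_category X \<kappa>"
    and I: "finite I" "I \<noteq> {}"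
    and U: "\<And>i. i \<in> I \<Longrightarrow> openin X (U i) \<and> U i \<noteq> {} \<and> \<kappa> (U i) \<le> n"
    and disj: "disjoint_family_on (\<lambda>i. X closure_of U i) I"
  shows "\<kappa> (\<Union>i\<in>I. U i) \<le> n"
proof -
  obtain h where h: "bij_betw h {1..card I} I"
    using ex_bij_betw_nat_finite_1[OF I(1)] by blast
  have im: "h ` {1..card I} = I" and inj: "inj_on h {1..card I}"
    using h by (auto simp: bij_betw_def)
  have ge1: "1 \<le> card I"
    using I by (simp add: Suc_leI card_gt_0_iff)
  have Uh: "\<forall>j\<in>{1..card I}. openin X (U (h j)) \<and> U (h j) \<noteq> {}"
    using U im by blast
  have dj: "disjoint_family_on (\<lambda>j. X closure_of U (h j)) {1..card I}"
    unfolding disjoint_family_on_def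
  proof (intro ballI impI)
    fix i j assume "i \<in> {1..card I}" "j \<in> {1..card I}" "i \<noteq> j"
    then have "h i \<in> I" "h j \<in> I" "h i \<noteq> h j"
      using im inj by (auto dest: inj_onD)
    then show "X closure_of U (h i) \<inter> X closure_of U (h j) = {}"
      by (rule disjoint_family_onD[OF disj])
  qed
  have "\<kappa> (\<Union>j\<in>{1..card I}. U (h j)) \<le> Max ((\<lambda>j. \<kappa> (U (h j))) ` {1..card I})"
    by (rule \<kappa>[unfolded generalized_relative_category_def, THEN conjunct2, THEN conjunct2,
          THEN conjunct2, THEN spec, THEN spec, THEN mp]) (intro conjI ge1 Uh dj)
  also have "\<dots> \<le> n"
    using ge1 U im by (subst Max_le_iff) auto
  also have "(\<Union>j\<in>{1..card I}. U (h j)) = (\<Union>i\<in>I. U i)"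
    using arg_cong[OF im, of "\<lambda>J. \<Union>(U ` J)"] by (simp only: image_image)
  finally show ?thesis .
qed

section \<open>Shrinking and colouring of open covers in compact Hausdorff spaces\<close>

text \<open>Regularity gives each point an open neighbourhood whose closure lies in some member
  \<open>W i\<close>. Compactness keeps finitely many of these, and \<open>G i\<close> is the union
  of those assigned to \<open>i\<close>.\<close>

lemma open_cover_shrinking:
  assumes "compact_space T" "Hausdorff_space T"
    and W: "\<forall>i\<in>I. openin T (W i)"
    and cov: "topspace T \<subseteq> (\<Union>i\<in>I. W i)"
  shows "\<exists>G. (\<forall>i\<in>I. openin T (G i) \<and> T closure_of G i \<subseteq> W i) \<and> topspace T \<subseteq> (\<Union>i\<in>I. G i)"
proof -
  have reg: "regular_space T"
    using assms(1,2) by (simp add: compact_Hausdorff_imp_regular_space)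
  have "\<exists>i B. i \<in> I \<and> openin T B \<and> y \<in> B \<and> T closure_of B \<subseteq> W i" if y: "y \<in> topspace T" for y
  proof -
    obtain i where i: "i \<in> I" "y \<in> W i"
      using cov y by blast
    have "neighbourhood_base_of (closedin T) T"
      using reg by (simp add: neighbourhood_base_of_closedin)
    then obtain B V where "openin T B" "closedin T V" "y \<in> B" "B \<subseteq> V" "V \<subseteq> W i"
      using W i unfolding neighbourhood_base_of by meson
    moreover then have "T closure_of B \<subseteq> V"
      by (simp add: closure_of_minimal)
    ultimately show ?thesis using i(1) by blast
  qed
  then obtain s B where sB: "\<And>y. y \<in> topspace T \<Longrightarrow>
      s y \<in> I \<and> openin T (B y) \<and> y \<in> B y \<and> T closure_of B y \<subseteq> W (s y)"
    by metis
  have "topspace T \<subseteq> \<Union>(B ` topspace T)"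
    using sB by blast
  moreover have "\<And>U. U \<in> B ` topspace T \<Longrightarrow> openin T U"
    using sB by blast
  ultimately obtain \<F> where "finite \<F>" "\<F> \<subseteq> B ` topspace T" "topspace T \<subseteq> \<Union>\<F>"
    using \<open>compact_space T\<close> unfolding compact_space_alt by meson
  then obtain F where F: "finite F" "F \<subseteq> topspace T" "topspace T \<subseteq> \<Union>(B ` F)"
    by (metis finite_subset_image)
  define G where "G i = \<Union>(B ` {y\<in>F. s y = i})" for i
  show ?thesis
  proof (intro exI[of _ G] conjI ballI)
    show "openin T (G i)" for i
      unfolding G_def using sB F(2) by (intro openin_Union) auto
    \<comment> \<open>Since \<open>F\<close> is finite, the closure of this union is the union of
      the closures.\<close>
    show "T closure_of G i \<subseteq> W i" for i
      unfolding G_def using sB F by (subst closure_of_Union) auto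
    show "topspace T \<subseteq> (\<Union>i\<in>I. G i)"
    proof
      fix x assume "x \<in> topspace T"
      then obtain y where "y \<in> F" "x \<in> B y"
        using F(3) by blast
      moreover from this have "s y \<in> I"
        using sB F(2) by blast
      ultimately show "x \<in> (\<Union>i\<in>I. G i)"
        unfolding G_def by blast
    qed
  qed
qed

text \<open>
  A colouring in the style of Ostrand: if continuous functions \<open>\<phi>\<close> have their positivity sets in
  the members of a finite cover, then a point at which the values of \<open>\<phi>\<close> on a subfamily \<open>S\<close>
  exceed all others gets the colour \<open>card S\<close>; distinct subfamilies of one size cannot both dominate.
\<close>
lemma covering_dim_le_disjoint_closures:
  assumes compact: "compact_space T" and Hausdorff: "Hausdorff_space T"
    and dim: "covering_dim_le T d" and cover: "open_cover_of T \<U>"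
  obtains \<G> :: "nat \<Rightarrow> 'b set set" where
    "\<And>k. k < nat (d + 1) \<Longrightarrow> finite (\<G> k)"
    "\<And>k G. k < nat (d + 1) \<Longrightarrow> G \<in> \<G> k \<Longrightarrow> openin T G \<and> (\<exists>U\<in>\<U>. G \<subseteq> U)"
    "\<And>k. k < nat (d + 1) \<Longrightarrow> disjoint_family_on (\<lambda>G. T closure_of G) (\<G> k)"
    "topspace T \<subseteq> (\<Union>k<nat (d + 1). \<Union>(\<G> k))"
proof -
  obtain \<V> where \<V>: "open_cover_of T \<V>" "\<And>V. V \<in> \<V> \<Longrightarrow> \<exists>U\<in>\<U>. V \<subseteq> U"
    "\<And>x. x \<in> topspace T \<Longrightarrow> finite {V\<in>\<V>. x \<in> V} \<and> int (card {V\<in>\<V>. x \<in> V}) \<le> d + 1"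
    using dim cover unfolding covering_dim_le_def by meson
  have "topspace T \<subseteq> \<Union>\<V>" "\<And>V. V \<in> \<V> \<Longrightarrow> openin T V"
    using \<V>(1) by (auto simp: open_cover_of_def)
  then obtain C where C: "finite C" "C \<subseteq> \<V>" "topspace T \<subseteq> \<Union>C"
    using compact unfolding compact_space_alt by meson
  have openC: "openin T V" if "V \<in> C" for V
    using that C \<V>(1) by (auto simp: open_cover_of_def)
  have covC: "topspace T \<subseteq> (\<Union>V\<in>C. V)"
    using C(3) by simp
  obtain D where D: "\<And>V. V \<in> C \<Longrightarrow> openin T (D V)" "\<And>V. V \<in> C \<Longrightarrow> T closure_of D V \<subseteq> V"
    "topspace T \<subseteq> (\<Union>V\<in>C. D V)"
    using open_cover_shrinking[OF compact Hausdorff _ covC] openC by blast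
  have normal: "normal_space T"
    using compact Hausdorff by (simp add: compact_Hausdorff_or_regular_imp_normal_space)
  \<comment> \<open>Urysohn's lemma separates the closed set \<open>topspace T - V\<close> (value 0)
    from the closure of \<open>D V\<close> (value 1).\<close>
  have "\<exists>g. continuous_map T euclideanreal g \<and> (\<forall>y\<in>D V. 0 < g y) \<and>
      (\<forall>y\<in>topspace T. 0 < g y \<longrightarrow> y \<in> V)" if V: "V \<in> C" for V
  proof -
    have "disjnt (topspace T - V) (T closure_of D V)"
      using D(2)[OF V] by (auto simp: disjnt_def)
    then obtain g where g: "continuous_map T (top_of_set {0..1::real}) g"
      "g ` (topspace T - V) \<subseteq> {0}" "g ` (T closure_of D V) \<subseteq> {1}"
      using Urysohn_lemma[OF normal, of "topspace T - V" "T closure_of D V" 0 1] openC[OF V]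
      by auto
    have "D V \<subseteq> T closure_of D V"
      using D(1)[OF V] by (simp add: closure_of_subset openin_subset)
    then have "g y = 1" if "y \<in> D V" for y
      using g(3) that by blast
    moreover have "g y = 0" if "y \<in> topspace T" "y \<notin> V" for y
      using g(2) that by blast
    moreover have "continuous_map T euclideanreal g"
      using g(1) by (simp add: continuous_map_in_subtopology)
    ultimately show ?thesis
      by (metis less_irrefl zero_less_one)
  qed
  then obtain \<phi> where \<phi>: "\<And>V. V \<in> C \<Longrightarrow> continuous_map T euclideanreal (\<phi> V)"
    "\<And>V y. V \<in> C \<Longrightarrow> y \<in> D V \<Longrightarrow> 0 < \<phi> V y"
    "\<And>V y. V \<in> C \<Longrightarrow> y \<in> topspace T \<Longrightarrow> 0 < \<phi> V y \<Longrightarrow> y \<in> V"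
    by metis
  \<comment> \<open>Positivity places \<open>W S\<close> inside every member of \<open>S\<close>;
    dominance over \<open>C - S\<close> separates the sets of one colour.\<close>
  define W where "W S = {y \<in> topspace T. (\<forall>V\<in>S. 0 < \<phi> V y) \<and> (\<forall>V\<in>S. \<forall>V'\<in>C - S. \<phi> V' y < \<phi> V y)}" for S
  define I where "I = {S. S \<subseteq> C \<and> S \<noteq> {} \<and> int (card S) \<le> d + 1}"
  have finI: "finite I"
    using C(1) by (auto simp: I_def)
  have openW: "openin T (W S)" if S: "S \<in> I" for S
  proof -
    have fin: "finite S" "finite (C - S)" "S \<subseteq> C"
      using S C(1) by (auto simp: I_def intro: finite_subset)
    have 1: "openin T {y \<in> topspace T. 0 < \<phi> V y}" if "V \<in> C" for V
    proof -
      have "openin T {y \<in> topspace T. \<phi> V y \<in> {0<..}}"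
        by (rule openin_continuous_map_preimage[OF \<phi>(1)[OF that]]) (simp add: open_openin[symmetric])
      then show ?thesis by simp
    qed
    have 2: "openin T {y \<in> topspace T. \<phi> V' y < \<phi> V y}" if "V \<in> C" "V' \<in> C" for V V'
    proof -
      have "continuous_map T euclideanreal (\<lambda>y. \<phi> V y - \<phi> V' y)"
        by (intro continuous_map_diff \<phi>(1) that)
      then have "openin T {y \<in> topspace T. \<phi> V y - \<phi> V' y \<in> {0<..}}"
        by (rule openin_continuous_map_preimage) (simp add: open_openin[symmetric])
      then show ?thesis by simp
    qed
    \<comment> \<open>The product is empty when \<open>S = C\<close>; intersecting with
      \<open>topspace T\<close> keeps the empty intersection inside the space.\<close>
    have "W S = (\<Inter>V\<in>S. {y \<in> topspace T. 0 < \<phi> V y}) \<inter> topspace T \<inter>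
        ((\<Inter>p\<in>S \<times> (C - S). {y \<in> topspace T. \<phi> (snd p) y < \<phi> (fst p) y}) \<inter> topspace T)"
      unfolding W_def by auto
    also have "openin T \<dots>"
      using fin by (intro openin_Int openin_INT 1 2) auto
    finally show ?thesis .
  qed
  have covW: "topspace T \<subseteq> (\<Union>S\<in>I. W S)"
  proof
    fix y assume y: "y \<in> topspace T"
    \<comment> \<open>These members dominate at \<open>y\<close>, as all other values there are at
      most 0. They all contain \<open>y\<close>, so the order of \<open>\<V>\<close> bounds their
      number.\<close>
    define S where "S = {V\<in>C. 0 < \<phi> V y}"
    have "S \<subseteq> {V\<in>\<V>. y \<in> V}"
      using \<phi>(3) y C(2) by (auto simp: S_def)
    then have "card S \<le> card {V\<in>\<V>. y \<in> V}"
      using \<V>(3)[OF y] by (intro card_mono) auto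
    then have "int (card S) \<le> d + 1"
      using \<V>(3)[OF y] by linarith
    moreover have "S \<noteq> {}"
      using D(3) y \<phi>(2) unfolding S_def by blast
    ultimately have "S \<in> I"
      by (auto simp: I_def S_def)
    moreover have "y \<in> W S"
      using y by (force simp: W_def S_def)
    ultimately show "y \<in> (\<Union>S\<in>I. W S)" by blast
  qed
  have disjW: "W S \<inter> W S' = {}" if "S \<in> I" "S' \<in> I" "card S = card S'" "S \<noteq> S'" for S S'
  proof -
    have fin: "finite S" "finite S'" "S \<subseteq> C" "S' \<subseteq> C"
      using that C(1) by (auto simp: I_def intro: finite_subset)
    \<comment> \<open>Finite sets of equal size are nested only if equal. A member of each set
      missing from the other then yields contradictory strict inequalities at a common
      point.\<close>
    have "\<not> S \<subseteq> S'" "\<not> S' \<subseteq> S"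
      using fin that card_subset_eq by metis+
    then obtain V V' where "V \<in> S" "V \<notin> S'" "V' \<in> S'" "V' \<notin> S"
      by blast
    then have "\<phi> V' y < \<phi> V y" if "y \<in> W S" for y
      using that fin by (auto simp: W_def)
    moreover have "\<phi> V y < \<phi> V' y" if "y \<in> W S'" for y
      using that fin \<open>V \<in> S\<close> \<open>V \<notin> S'\<close> \<open>V' \<in> S'\<close> by (auto simp: W_def)
    ultimately show ?thesis by fastforce
  qed
  \<comment> \<open>The second shrinking turns disjointness of the open sets \<open>W S\<close> into
    disjointness of the closures of the \<open>G S\<close>.\<close>
  obtain G where G: "\<And>S. S \<in> I \<Longrightarrow> openin T (G S)" "\<And>S. S \<in> I \<Longrightarrow> T closure_of G S \<subseteq> W S"
    "topspace T \<subseteq> (\<Union>S\<in>I. G S)"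
    using open_cover_shrinking[OF compact Hausdorff _ covW] openW by blast
  have GW: "G S \<subseteq> W S" if "S \<in> I" for S
    using G(1,2)[OF that] closure_of_subset[OF openin_subset] by blast
  \<comment> \<open>Sizes in \<open>I\<close> run from 1 to \<open>d + 1\<close>, whereas colours
    are counted from 0.\<close>
  define \<G> where "\<G> k = G ` {S\<in>I. card S = Suc k}" for k
  show thesis
  proof (rule that[of \<G>])
    show "finite (\<G> k)" for k
      using finI by (simp add: \<G>_def)
    show "openin T H \<and> (\<exists>U\<in>\<U>. H \<subseteq> U)" if H: "H \<in> \<G> k" for k H
    proof -
      obtain S where S: "S \<in> I" "H = G S"
        using H by (auto simp: \<G>_def)
      then obtain V where V: "V \<in> S" "V \<in> C"
        by (auto simp: I_def)
      have "H \<subseteq> V"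
        using GW[OF S(1)] S(2) V \<phi>(3) by (auto simp: W_def)
      moreover obtain U where "U \<in> \<U>" "V \<subseteq> U"
        using \<V>(2) V C(2) by blast
      ultimately show ?thesis using G(1) S by blast
    qed
    show "disjoint_family_on (\<lambda>H. T closure_of H) (\<G> k)" for k
      unfolding disjoint_family_on_def
    proof (intro ballI impI)
      fix H H' assume "H \<in> \<G> k" "H' \<in> \<G> k" "H \<noteq> H'"
      then obtain S S' where S: "S \<in> I" "card S = Suc k" "H = G S"
        and S': "S' \<in> I" "card S' = Suc k" "H' = G S'"
        unfolding \<G>_def by blast
      have "W S \<inter> W S' = {}"
        using S S' \<open>H \<noteq> H'\<close> by (intro disjW) auto
      then show "T closure_of H \<inter> T closure_of H' = {}"
        using G(2) S S' by blast
    qed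
    show "topspace T \<subseteq> (\<Union>k<nat (d + 1). \<Union>(\<G> k))"
    proof
      fix y assume "y \<in> topspace T"
      then obtain S where S: "S \<in> I" "y \<in> G S"
        using G(3) by blast
      then have "finite S" "S \<noteq> {}"
        using C(1) by (auto simp: I_def intro: finite_subset)
      then have k: "card S = Suc (card S - 1)"
        by (simp add: card_gt_0_iff)
      moreover have "card S - 1 < nat (d + 1)"
        using k S(1) by (auto simp: I_def)
      ultimately show "y \<in> (\<Union>k<nat (d + 1). \<Union>(\<G> k))"
        using S unfolding \<G>_def by blast
    qed
  qed
qed

section \<open>Pulling the coloured cover back from \<open>Y\<close> to \<open>X\<close>\<close>

theorem theorem1:
  fixes X :: "'a topology" and \<kappa> :: "'a set \<Rightarrow> int"
    and Y :: "'b set" and \<delta> :: "'b \<Rightarrow> 'b \<Rightarrow> real"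
    and d n :: int and f :: "'a \<Rightarrow> 'b"
  assumes "topspace X \<noteq> {}"
    and "generalized_relative_category X \<kappa>"
    and "Metric_space Y \<delta>"
    and "compact_space (Metric_space.mtopology Y \<delta>)"
    and "has_covering_dim (Metric_space.mtopology Y \<delta>) d"
    and "\<kappa> (topspace X) > n * (d + 1)"
    and "continuous_map X (Metric_space.mtopology Y \<delta>) f"
  shows "\<exists>c\<in>Y. \<forall>U. openin (Metric_space.mtopology Y \<delta>) U \<and> c \<in> U \<longrightarrow>
           {x \<in> topspace X. f x \<in> U} \<noteq> {} \<and> \<kappa> {x \<in> topspace X. f x \<in> U} > n"
proof (rule ccontr)
  interpret Metric_space Y \<delta> by (rule assms)
  define pre where "pre U = {x \<in> topspace X. f x \<in> U}" for U
  define \<U> where "\<U> = {U. openin mtopology U \<and> (pre U \<noteq> {} \<longrightarrow> \<kappa> (pre U) \<le> n)}"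
  note \<kappa> = assms(2)
  have open_pre: "openin X (pre U)" if "openin mtopology U" for U
    unfolding pre_def using assms(7) that by (rule openin_continuous_map_preimage)
  assume "\<not> ?thesis"
  then have "\<exists>U\<in>\<U>. c \<in> U" if "c \<in> Y" for c
    using that unfolding \<U>_def pre_def by force
  moreover have "U \<subseteq> Y" if "U \<in> \<U>" for U
    using that openin_subset by (fastforce simp: \<U>_def)
  ultimately have "open_cover_of mtopology \<U>"
    by (auto simp: open_cover_of_def \<U>_def)
  moreover have "covering_dim_le mtopology d"
    using assms(5) by (simp add: has_covering_dim_def)
  ultimately obtain \<G> where \<G>: "\<And>k. k < nat (d + 1) \<Longrightarrow> finite (\<G> k)"
    "\<And>k G. k < nat (d + 1) \<Longrightarrow> G \<in> \<G> k \<Longrightarrow> openin mtopology G \<and> (\<exists>U\<in>\<U>. G \<subseteq> U)"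
    "\<And>k. k < nat (d + 1) \<Longrightarrow> disjoint_family_on (\<lambda>G. mtopology closure_of G) (\<G> k)"
    "topspace mtopology \<subseteq> (\<Union>k<nat (d + 1). \<Union>(\<G> k))"
    using covering_dim_le_disjoint_closures[OF assms(4) Hausdorff_space_mtopology] by metis
  \<comment> \<open>Members with empty preimage, and then colours left without members, are
    discarded so that the axioms on nonempty open sets apply.\<close>
  define \<H> where "\<H> k = {G \<in> \<G> k. pre G \<noteq> {}}" for k
  define K where "K = {k. k < nat (d + 1) \<and> \<H> k \<noteq> {}}"
  define B where "B k = (\<Union>G\<in>\<H> k. pre G)" for k
  have \<H>: "openin X (pre G) \<and> pre G \<noteq> {} \<and> \<kappa> (pre G) \<le> n" if k: "k \<in> K" and G: "G \<in> \<H> k" for k G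
  proof -
    have "k < nat (d + 1)" "G \<in> \<G> k" "pre G \<noteq> {}"
      using k G by (auto simp: \<H>_def K_def)
    then obtain U where U: "U \<in> \<U>" "G \<subseteq> U" "openin mtopology G" "pre G \<noteq> {}"
      using \<G>(2) by blast
    have "pre G \<subseteq> pre U"
      using U(2) by (auto simp: pre_def)
    then have "\<kappa> (pre G) \<le> \<kappa> (pre U)" "\<kappa> (pre U) \<le> n"
      using relative_category_mono[OF \<kappa> open_pre[OF U(3)] U(4) open_pre] U by (auto simp: \<U>_def)
    then show ?thesis
      using open_pre U by simp
  qed
  have B: "openin X (B k) \<and> B k \<noteq> {} \<and> \<kappa> (B k) \<le> n" if k: "k \<in> K" for k
  proof (intro conjI)
    show "openin X (B k)"
      unfolding B_def using \<H>[OF k] by blast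
    show "B k \<noteq> {}"
      using k by (auto simp: B_def \<H>_def K_def)
    have "disjoint_family_on (\<lambda>G. X closure_of pre G) (\<H> k)"
      unfolding disjoint_family_on_def
    proof (intro ballI impI)
      fix G H assume "G \<in> \<H> k" "H \<in> \<H> k" "G \<noteq> H"
      then have "mtopology closure_of G \<inter> mtopology closure_of H = {}"
        using \<G>(3)[of k] k by (auto simp: \<H>_def K_def disjoint_family_on_def)
      \<comment> \<open>By continuity, disjointness of closures in \<open>Y\<close> passes to the
        closures of the preimages in \<open>X\<close>.\<close>
      moreover have "X closure_of pre A \<subseteq> {x \<in> topspace X. f x \<in> mtopology closure_of A}" for A
        unfolding pre_def by (rule continuous_map_closure_preimage_subset[OF assms(7)])
      ultimately show "X closure_of pre G \<inter> X closure_of pre H = {}"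
        by fast
    qed
    moreover have "finite (\<H> k)" "\<H> k \<noteq> {}"
      using \<G>(1) k by (auto simp: \<H>_def K_def)
    ultimately show "\<kappa> (B k) \<le> n"
      unfolding B_def using \<H>[OF k] by (intro relative_category_UN_le_bound[OF \<kappa>]) auto
  qed
  have X_eq: "topspace X = (\<Union>k\<in>K. B k)"
  proof (intro equalityI subsetI)
    fix x assume x: "x \<in> topspace X"
    then have "f x \<in> topspace mtopology"
      using assms(7) by (auto simp: continuous_map_def)
    then obtain k G where "k < nat (d + 1)" "G \<in> \<G> k" "f x \<in> G"
      using \<G>(4) by blast
    then show "x \<in> (\<Union>k\<in>K. B k)"
      using x unfolding K_def B_def \<H>_def pre_def by blast
  qed (auto simp: B_def pre_def)
  have K: "finite K" "K \<noteq> {}"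
    using X_eq assms(1) by (auto simp: K_def)
  have "card K \<le> card {..<nat (d + 1)}"
    by (intro card_mono) (auto simp: K_def)
  \<comment> \<open>A colour in \<open>K\<close> forces \<open>d + 1\<close> to be positive, so
    \<open>nat (d + 1)\<close> does not truncate.\<close>
  moreover obtain k where k: "k \<in> K"
    using K by blast
  ultimately have card_K: "int (card K) \<le> d + 1"
    by (auto simp: K_def)
  \<comment> \<open>The sign of \<open>n\<close> allows the bound on \<open>card K\<close> to be
    multiplied by it.\<close>
  have "0 < n"
    using B[OF k] relative_category_pos[OF \<kappa>, of "B k"] by linarith
  have "\<kappa> (topspace X) \<le> (\<Sum>k\<in>K. \<kappa> (B k))"
    unfolding X_eq using B by (intro relative_category_UN_le_sum[OF \<kappa> K]) auto
  also have "\<dots> \<le> int (card K) * n"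
    using B by (intro sum_bounded_above) auto
  also have "\<dots> \<le> (d + 1) * n"
    using card_K \<open>0 < n\<close> by (intro mult_right_mono) auto
  finally show False
    using assms(6) by (simp add: mult.commute)
qed

end
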